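(* Every oriented graph $D$ on $n$ vertices, none of which is isolated, satisfies $ow(D)\ge \dfrac{n}{9\lceil \log_{2} n\rceil}$.
   Context: An oriented graph $D$ is a finite directed graph without loops in which, for each pair of distinct vertices $x,y$, at most one of $\vec{xy},\vec{yx}$ is an arc. A vertex is isolated if it is incident to no arc. For (not necessarily disjoint) $A,B\subseteq V(D)$, $e(A,B)$ is the number of arcs $\vec{xy}$ of $D$ with $x\in A$, $y\in B$. Define $ow(D)=\max\{e(A,B): A,B\subseteq V(D),\ e(B,A)=0\}$. *)

theory Defs
  imports Complex_Main "Graph_Theory.Pair_Digraph"
begin

text \<open>Arcs of a \<open>pair_digraph\<close> are ordered pairs of vertices, so parallel arcs cannot occur.\<close>

locale oriented_graph = pair_digraph D for D :: "'a pair_pre_digraph" +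
  assumes no_opposite_arcs: "x \<noteq> y \<Longrightarrow> \<not> ((x, y) \<in> parcs D \<and> (y, x) \<in> parcs D)"

definition isolated :: "'a pair_pre_digraph \<Rightarrow> 'a \<Rightarrow> bool" where
  "isolated D v \<longleftrightarrow> v \<in> pverts D \<and> \<not> (\<exists>a \<in> parcs D. fst a = v \<or> snd a = v)"

definition arcs_between :: "'a pair_pre_digraph \<Rightarrow> 'a set \<Rightarrow> 'a set \<Rightarrow> nat" where
  "arcs_between D A B = card {a \<in> parcs D. fst a \<in> A \<and> snd a \<in> B}"

definition ow :: "'a pair_pre_digraph \<Rightarrow> nat" where
  "ow D = Max {arcs_between D A B | A B.
     A \<subseteq> pverts D \<and> B \<subseteq> pverts D \<and> arcs_between D B A = 0}"

text \<open>The maximum is taken over a finite nonempty set, so \<open>Max\<close> is well defined.\<close>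

lemma (in oriented_graph) ow_set:
  defines "S \<equiv> {arcs_between D A B | A B.
     A \<subseteq> pverts D \<and> B \<subseteq> pverts D \<and> arcs_between D B A = 0}"
  shows "finite S" and "S \<noteq> {}"
proof -
  have "S \<subseteq> (\<lambda>(A, B). arcs_between D A B) ` (Pow (pverts D) \<times> Pow (pverts D))"
    unfolding S_def by auto
  then show "finite S"
    using pair_finite_verts by (meson finite_Pow_iff finite_SigmaI finite_imageI finite_subset)
  have "arcs_between D {} {} = 0"
    by (simp add: arcs_between_def)
  then show "S \<noteq> {}"
    unfolding S_def by blast
qed

end

theory Submission
  imports Defs
begin

text \<open>
  Let each vertex belong to \<open>A\<close> independently with probability \<open>p\<close>, and let \<open>B\<close> be the
  set of all vertices that send no arc to \<open>A\<close>. A vertex \<open>b\<close> with in-degree \<open>d\<close> and out-degree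
  \<open>d'\<close> contributes \<open>d p (1 - p)^d'\<close> to the expectation of \<open>e(A, B)\<close>, because its in-neighbours
  are not among its out-neighbours. Up to reversing all arcs, at least half of the vertices have
  \<open>d \<ge> d'\<close>, hence \<open>d \<ge> 1\<close>. One of the \<open>\<lceil>log\<^sub>2 n\<rceil>\<close> dyadic ranges \<open>2^i \<le> d < 2^(i+1)\<close>
  contains a fair share of them, and for \<open>p = 1/2^(i+1)\<close> each vertex in this range
  contributes at least \<open>2/9\<close>.
\<close>

text \<open>Independent choices make the sum over \<open>A\<close> the expansion of a product over
  \<open>V\<close> of two-term sums. It is the probability that a random subset contains
  \<open>x\<close> and misses \<open>S\<close>.\<close>

lemma sum_binomial_weights_restricted:
  fixes p :: real
  assumes "finite V" "x \<in> V" "S \<subseteq> V" "x \<notin> S"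
  shows "(\<Sum>A\<in>Pow V. p ^ card A * (1 - p) ^ card (V - A) * of_bool (x \<in> A \<and> A \<inter> S = {}))
    = p * (1 - p) ^ card S"
proof -
  \<comment> \<open>\<open>f\<close> weighs a chosen vertex and \<open>g\<close> an unchosen one; a
    zero factor kills every subset violating the condition.\<close>
  define f where "f v = p * of_bool (v \<notin> S)" for v
  define g where "g v = (1 - p) * of_bool (v \<noteq> x)" for v
  have weight: "p ^ card A * (1 - p) ^ card (V - A) * of_bool (x \<in> A \<and> A \<inter> S = {})
      = prod f A * prod g (V - A)" if "A \<in> Pow V" for A
  proof -
    have "finite A" using that assms(1) finite_subset by auto
    then have "prod f A = p ^ card A * of_bool (A \<inter> S = {})"
      unfolding f_def by (subst prod.distrib) (auto simp: prod_zero_iff intro!: prod.neutral)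
    moreover have "prod g (V - A) = (1 - p) ^ card (V - A) * of_bool (x \<in> A)"
      unfolding g_def using assms(1,2)
      by (subst prod.distrib) (auto simp: prod_zero_iff intro!: prod.neutral)
    ultimately show ?thesis by auto
  qed
  have "(\<Sum>A\<in>Pow V. p ^ card A * (1 - p) ^ card (V - A) * of_bool (x \<in> A \<and> A \<inter> S = {}))
      = (\<Prod>v\<in>V. f v + g v)"
    using assms(1) by (simp only: prod_add sum.cong[OF refl weight])
  \<comment> \<open>The sum \<open>f v + g v\<close> is \<open>p\<close> at \<open>x\<close>,
    \<open>1 - p\<close> on \<open>S\<close>, and \<open>p + (1 - p) = 1\<close> elsewhere.\<close>
  also have "\<dots> = (\<Prod>v\<in>V. (if v = x then p else 1) * (if v \<in> S then 1 - p else 1))"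
    using assms(4) by (intro prod.cong) (auto simp: f_def g_def)
  also have "\<dots> = (\<Prod>v\<in>V. if v = x then p else 1) * (\<Prod>v\<in>V. if v \<in> S then 1 - p else 1)"
    by (rule prod.distrib)
  also have "(\<Prod>v\<in>V. if v \<in> S then 1 - p else 1) = (1 - p) ^ card S"
    using assms(1,3) by (simp add: prod.If_cases Int_absorb1)
  finally show ?thesis using assms(1,2) by (simp add: prod.delta)
qed

lemma sum_binomial_weights:
  fixes p :: real
  assumes "finite V"
  shows "(\<Sum>A\<in>Pow V. p ^ card A * (1 - p) ^ card (V - A)) = 1"
  using prod_add[OF assms, of "\<lambda>_. p" "\<lambda>_. 1 - p"] by simp

text \<open>Linearity of expectation over the arcs, after which some outcome reaches the mean.
  Working with a relation lets the result serve the reversed arcs too.\<close>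

lemma one_way_pair_expectation:
  fixes p :: real
  assumes "finite V" "R \<subseteq> V \<times> V" "asym R" "0 \<le> p" "p \<le> 1"
  obtains A B where "A \<subseteq> V" "B \<subseteq> V" "R \<inter> (B \<times> A) = {}"
    "(\<Sum>b\<in>V. card (R\<inverse> `` {b}) * p * (1 - p) ^ card (R `` {b})) \<le> card (R \<inter> (A \<times> B))"
proof -
  define w where "w A = p ^ card A * (1 - p) ^ card (V - A)" for A :: "'a set"
  define B where "B A = {b\<in>V. A \<inter> R `` {b} = {}}" for A
  define T where "T = (\<Sum>b\<in>V. card (R\<inverse> `` {b}) * p * (1 - p) ^ card (R `` {b}))"
  have finR: "finite R" using assms(1,2) finite_subset by blast
  have count: "real (card (R \<inter> (A \<times> B A)))
      = (\<Sum>(a, b)\<in>R. of_bool (a \<in> A \<and> A \<inter> R `` {b} = {}))" for A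
  proof -
    have "R \<inter> (A \<times> B A) = {ab\<in>R. case ab of (a, b) \<Rightarrow> a \<in> A \<and> A \<inter> R `` {b} = {}}"
      using assms(2) by (auto simp: B_def)
    then show ?thesis
      using finR by (simp add: case_prod_unfold flip: sum.inter_filter)
        (simp add: of_bool_def sum.If_cases Int_def conj_commute)
  qed
  \<comment> \<open>Grouping arcs by their head \<open>b\<close> turns the sum into in-degree times
    a term depending on \<open>b\<close> alone.\<close>
  have R_eq: "R = (\<lambda>(b, a). (a, b)) ` (SIGMA b:V. R\<inverse> `` {b})"
    using assms(2) by (force simp: image_def)
  have "(\<Sum>A\<in>Pow V. w A * card (R \<inter> (A \<times> B A)))
      = (\<Sum>(a, b)\<in>R. \<Sum>A\<in>Pow V. w A * of_bool (a \<in> A \<and> A \<inter> R `` {b} = {}))"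
    unfolding count sum_distrib_left case_prod_unfold by (rule sum.swap)
  also have "\<dots> = (\<Sum>(a, b)\<in>R. p * (1 - p) ^ card (R `` {b}))"
  proof (intro sum.cong refl, clarify)
    fix a b assume ab: "(a, b) \<in> R"
    then have "a \<notin> R `` {b}" using assms(3) by (auto dest: asymD)
    then show "(\<Sum>A\<in>Pow V. w A * of_bool (a \<in> A \<and> A \<inter> R `` {b} = {}))
        = p * (1 - p) ^ card (R `` {b})"
      unfolding w_def using ab assms(1,2) by (intro sum_binomial_weights_restricted) auto
  qed
  also have "\<dots> = (\<Sum>(b, a)\<in>(SIGMA b:V. R\<inverse> `` {b}). p * (1 - p) ^ card (R `` {b}))"
    by (subst R_eq, subst sum.reindex) (auto simp: inj_on_def case_prod_unfold)
  also have "\<dots> = T"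
  proof -
    have "finite (R\<inverse> `` {b})" for b using finR by (simp add: finite_Image)
    then show ?thesis
      unfolding T_def using assms(1) by (subst sum.Sigma[symmetric]) (auto simp: mult.assoc)
  qed
  finally have expectation: "(\<Sum>A\<in>Pow V. w A * card (R \<inter> (A \<times> B A))) = T" .
  have "\<exists>A\<in>Pow V. T \<le> card (R \<inter> (A \<times> B A))"
  proof (rule ccontr)
    assume "\<not> ?thesis"
    then have less: "card (R \<inter> (A \<times> B A)) < T" if "A \<in> Pow V" for A
      using that by (auto simp: not_le)
    have w_nonneg: "0 \<le> w A" for A using assms(4,5) by (simp add: w_def)
    have w_sum: "sum w (Pow V) = 1"
      unfolding w_def by (rule sum_binomial_weights[OF assms(1)])
    \<comment> \<open>For \<open>p\<close> equal to 0 or 1 some weights vanish; strictness of the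
      averaged inequality needs one positive weight.\<close>
    then obtain A where A: "A \<in> Pow V" "w A \<noteq> 0" by (metis sum.neutral zero_neq_one)
    have "(\<Sum>A\<in>Pow V. w A * card (R \<inter> (A \<times> B A))) < (\<Sum>A\<in>Pow V. w A * T)"
    proof (rule sum_strict_mono_ex1)
      show "\<forall>A\<in>Pow V. w A * card (R \<inter> (A \<times> B A)) \<le> w A * T"
        by (intro ballI mult_left_mono less_imp_le[OF less] w_nonneg)
      show "\<exists>A\<in>Pow V. w A * card (R \<inter> (A \<times> B A)) < w A * T"
        using A(2) w_nonneg[of A] by (intro bexI[OF _ A(1)] mult_strict_left_mono less A(1)) simp
    qed (use assms(1) in simp)
    then show False using expectation w_sum by (simp flip: sum_distrib_right)
  qed
  then obtain A where "A \<subseteq> V" "T \<le> card (R \<inter> (A \<times> B A))" by auto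
  moreover have "B A \<subseteq> V" "R \<inter> (B A \<times> A) = {}" by (auto simp: B_def)
  ultimately show thesis using that unfolding T_def by blast
qed

text \<open>With \<open>x = d / N\<close>, Bernoulli's inequality bounds the power below by
  \<open>1 - x\<close>, and the estimate by 1/e \<ge> 1/3 bounds it by 1/3. The two agree at
  \<open>x = 2/3\<close>, which gives the case split and the constant 2/9.\<close>

lemma vertex_contribution_ge:
  fixes d N :: nat
  assumes "N \<le> 2 * d" "d < N"
  shows "2 / 9 \<le> d * (1 / N) * (1 - 1 / N) ^ d"
proof -
  define x where "x = real d / N"
  have N: "N \<ge> 2" and x: "1/2 \<le> x" "x < 1"
    using assms by (auto simp: x_def field_simps)
  show ?thesis
  proof (cases "x \<le> 2/3")
    case True
    have "1 + real d * (- (1 / N)) \<le> (1 + - (1 / N)) ^ d"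
      using N by (intro Bernoulli_inequality) simp
    then have "1 - x \<le> (1 - 1 / N) ^ d" by (simp add: x_def)
    then have "x * (1 - x) \<le> x * (1 - 1 / N) ^ d" using x by (intro mult_left_mono) auto
    \<comment> \<open>The product equals \<open>x * (1 - x) - 2/9\<close>.\<close>
    moreover have "0 \<le> (x - 1/3) * (2/3 - x)" using True x by (intro mult_nonneg_nonneg) auto
    then have "2 / 9 \<le> x * (1 - x)" by (simp add: field_simps)
    ultimately have "2 / 9 \<le> x * (1 - 1 / N) ^ d" by linarith
    then show ?thesis by (simp add: x_def)
  next
    case False
    define q where "q = 1 + 1 / real (N - 1)"
    have inv: "1 - 1 / N = 1 / q" using N by (simp add: q_def field_simps of_nat_diff)
    have "q ^ (N - 1) \<le> exp (1 / real (N - 1)) ^ (N - 1)"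
      unfolding q_def by (intro power_mono exp_ge_add_one_self) auto
    also have "\<dots> = exp 1" using N by (simp flip: exp_of_nat_mult)
    also have "\<dots> \<le> 3" by (rule exp_le)
    finally have q: "q ^ (N - 1) \<le> 3" .
    have "1 \<le> q" by (simp add: q_def)
    \<comment> \<open>The strict bound \<open>d < N\<close> matters: for \<open>N = 2\<close>,
      exponent \<open>N\<close> would give only 1/4.\<close>
    then have "q ^ d \<le> q ^ (N - 1)" using assms by (intro power_increasing) auto
    then have "1 / 3 \<le> 1 / q ^ d" using q \<open>1 \<le> q\<close> by (intro divide_left_mono) auto
    then have "1 / 3 \<le> (1 - 1 / N) ^ d" by (simp only: inv power_one_over)
    then have "2 / 3 * (1 / 3) \<le> x * (1 - 1 / N) ^ d"
      using False by (intro mult_mono) auto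
    then show ?thesis by (simp add: x_def)
  qed
qed

lemma dyadic_index_less:
  assumes "2 ^ i < (n :: nat)"
  shows "i < nat \<lceil>log 2 n\<rceil>"
proof -
  have "real i < log 2 n"
    using assms by (subst less_log_iff) (auto simp: powr_realpow simp flip: of_nat_power)
  then show ?thesis by linarith
qed

text \<open>Pigeonhole over dyadic in-degree classes. Positive in-degree puts each vertex of
  \<open>W\<close> in a class; domination allows the out-degree exponent to be replaced by the
  in-degree.\<close>

lemma one_way_pair_of_in_dominated:
  assumes "finite V" "R \<subseteq> V \<times> V" "asym R" "W \<subseteq> V"
    and dom: "\<And>v. v \<in> W \<Longrightarrow> card (R `` {v}) \<le> card (R\<inverse> `` {v}) \<and> 0 < card (R\<inverse> `` {v})"
  obtains A B where "A \<subseteq> V" "B \<subseteq> V" "R \<inter> (B \<times> A) = {}"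
    "2 / 9 * card W \<le> real (nat \<lceil>log 2 (card V)\<rceil>) * card (R \<inter> (A \<times> B))"
proof -
  define L where "L = nat \<lceil>log 2 (card V)\<rceil>"
  define U where "U i = {v\<in>W. 2 ^ i \<le> card (R\<inverse> `` {v}) \<and> card (R\<inverse> `` {v}) < 2 ^ (i + 1)}" for i
  have finW: "finite W" using assms(1,4) finite_subset by blast
  have "W \<subseteq> (\<Union>i<L. U i)"
  proof
    fix v assume v: "v \<in> W"
    obtain i where i: "2 ^ i \<le> card (R\<inverse> `` {v})" "card (R\<inverse> `` {v}) < 2 ^ (i + 1)"
      using ex_power_ivl1[of 2 "card (R\<inverse> `` {v})"] dom[OF v] by auto
    \<comment> \<open>Without loops \<open>v\<close> is not its own in-neighbour, so the in-degree
      is strictly below \<open>card V\<close> and \<open>L\<close> classes suffice.\<close>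
    have "R\<inverse> `` {v} \<subset> V" using assms(2,3,4) v by (auto dest: asymD)
    then have "card (R\<inverse> `` {v}) < card V" using assms(1) by (rule psubset_card_mono[rotated])
    then have "i < L" unfolding L_def using i by (intro dyadic_index_less) simp
    then show "v \<in> (\<Union>i<L. U i)" using i v by (auto simp: U_def)
  qed
  moreover have finU: "finite (U i)" for i using finW by (simp add: U_def)
  ultimately have "card W \<le> card (\<Union>i<L. U i)" by (intro card_mono) auto
  also have "\<dots> \<le> (\<Sum>i<L. card (U i))" by (rule card_UN_le) simp
  finally have W_le: "card W \<le> (\<Sum>i<L. card (U i))" .
  \<comment> \<open>The largest class is sought over all natural indices, so \<open>L = 0\<close>
    needs no separate treatment.\<close>
  have "card (U i) < Suc (card W)" for i
    using finW by (auto simp: U_def less_Suc_eq_le intro: card_mono)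
  then obtain i where "card (U j) \<le> card (U i)" for j
    using ex_has_greatest_nat[of "\<lambda>_. True" 0 "\<lambda>i. card (U i)" "Suc (card W)"] less_imp_le by blast
  then have "(\<Sum>i<L. card (U i)) \<le> L * card (U i)"
    using sum_bounded_above[of "{..<L}" "\<lambda>i. card (U i)"] by simp
  with W_le have i: "card W \<le> L * card (U i)" by simp
  define N :: nat where "N = 2 ^ (i + 1)"
  have "1 \<le> N" unfolding N_def by (rule one_le_power) simp
  then have p: "0 \<le> 1 / real N" "1 / real N \<le> 1" by auto
  obtain A B where AB: "A \<subseteq> V" "B \<subseteq> V" "R \<inter> (B \<times> A) = {}"
    and sum_le: "(\<Sum>b\<in>V. card (R\<inverse> `` {b}) * (1 / N) * (1 - 1 / N) ^ card (R `` {b}))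
      \<le> card (R \<inter> (A \<times> B))"
    using one_way_pair_expectation[OF assms(1-3) p] by blast
  have "2 / 9 * card (U i) = (\<Sum>b\<in>U i. 2 / 9 :: real)" by simp
  also have "\<dots> \<le> (\<Sum>b\<in>U i. card (R\<inverse> `` {b}) * (1 / N) * (1 - 1 / N) ^ card (R `` {b}))"
  proof (rule sum_mono)
    fix b assume b: "b \<in> U i"
    then have "2 / 9 \<le> card (R\<inverse> `` {b}) * (1 / N) * (1 - 1 / N) ^ card (R\<inverse> `` {b})"
      by (intro vertex_contribution_ge) (auto simp: U_def N_def)
    also have "\<dots> \<le> card (R\<inverse> `` {b}) * (1 / N) * (1 - 1 / N) ^ card (R `` {b})"
      using b dom p by (intro mult_left_mono power_decreasing) (auto simp: U_def)
    finally show "2 / 9 \<le> \<dots>" .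
  qed
  also have "\<dots> \<le> (\<Sum>b\<in>V. card (R\<inverse> `` {b}) * (1 / N) * (1 - 1 / N) ^ card (R `` {b}))"
    using assms(1,4) p by (intro sum_mono2) (auto simp: U_def)
  also note sum_le
  finally have "2 / 9 * card (U i) \<le> card (R \<inter> (A \<times> B))" .
  then have "L * (2 / 9 * card (U i)) \<le> L * real (card (R \<inter> (A \<times> B)))"
    by (intro mult_left_mono) auto
  moreover have "real (card W) \<le> L * card (U i)" using i by (metis of_nat_le_iff of_nat_mult)
  ultimately have "2 / 9 * card W \<le> real L * card (R \<inter> (A \<times> B))" by simp
  then show thesis using that AB unfolding L_def by blast
qed

theorem theorem6p1:
  fixes D :: "'a pair_pre_digraph" and n :: nat
  assumes "oriented_graph D"
    and "card (pverts D) = n"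
    and "\<forall>v \<in> pverts D. \<not> isolated D v"
  shows "real (ow D) \<ge> real n / (9 * real_of_int \<lceil>log 2 (real n)\<rceil>)"
proof -
  interpret oriented_graph D by fact
  define R where "R = parcs D"
  define V where "V = pverts D"
  define L where "L = nat \<lceil>log 2 (real n)\<rceil>"
  have finV: "finite V" by (simp add: V_def)
  have R: "R \<subseteq> V \<times> V"
    unfolding R_def V_def using in_arcsD1 in_arcsD2 by auto
  have "asym R"
    using no_opposite_arcs pair_no_loops unfolding R_def by (intro asymI) fastforce
  have finR: "finite R" using finV R finite_subset by blast
  have arcs: "arcs_between D A B = card (R \<inter> (A \<times> B))" for A B
    unfolding arcs_between_def R_def by (rule arg_cong[where f = card]) auto
  have ow_ge: "card (R \<inter> (A \<times> B)) \<le> ow D"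
    if "A \<subseteq> V" "B \<subseteq> V" "R \<inter> (B \<times> A) = {}" for A B
    unfolding ow_def
  proof (intro Max_ge ow_set(1) CollectI exI conjI)
    show "card (R \<inter> (A \<times> B)) = arcs_between D A B" "arcs_between D B A = 0"
      using that(3) by (simp_all add: arcs)
  qed (use that in \<open>simp_all add: V_def\<close>)
  \<comment> \<open>\<open>W\<close> and \<open>W'\<close> may overlap; only
    \<open>V = W \<union> W'\<close> is used.\<close>
  define W where "W = {v\<in>V. card (R `` {v}) \<le> card (R\<inverse> `` {v})}"
  define W' where "W' = {v\<in>V. card (R\<inverse> `` {v}) \<le> card (R `` {v})}"
  have pos: "0 < card (R `` {v}) \<or> 0 < card (R\<inverse> `` {v})" if "v \<in> V" for v
  proof -
    have "R `` {v} \<noteq> {} \<or> R\<inverse> `` {v} \<noteq> {}"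
      using assms(3) that unfolding isolated_def V_def R_def by fastforce
    then show ?thesis using finR by (simp add: card_gt_0_iff finite_Image)
  qed
  have cardV: "card V = n" using assms(2) by (simp add: V_def)
  have half: "n \<le> card W + card W'"
  proof -
    have "V = W \<union> W'" by (auto simp: W_def W'_def)
    then show ?thesis using card_Un_le[of W W'] cardV by simp
  qed
  have "W \<subseteq> V" "W' \<subseteq> V" by (auto simp: W_def W'_def)
  \<comment> \<open>In-degree 0 in \<open>W\<close> would force out-degree 0, making the vertex
    isolated.\<close>
  have "card (R `` {v}) \<le> card (R\<inverse> `` {v}) \<and> 0 < card (R\<inverse> `` {v})" if "v \<in> W" for v
    using that pos[of v] by (auto simp: W_def)
  from one_way_pair_of_in_dominated[OF finV R \<open>asym R\<close> \<open>W \<subseteq> V\<close> this]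
  obtain A B where AB: "A \<subseteq> V" "B \<subseteq> V" "R \<inter> (B \<times> A) = {}"
    and le: "2 / 9 * card W \<le> real L * card (R \<inter> (A \<times> B))"
    unfolding L_def cardV by blast
  note le
  also have "real L * card (R \<inter> (A \<times> B)) \<le> real L * ow D"
    using ow_ge[OF AB] by (intro mult_left_mono) auto
  finally have W_le: "2 / 9 * card W \<le> real L * ow D" .
  have conv: "R\<inverse> \<subseteq> V \<times> V" "asym (R\<inverse>)" using R \<open>asym R\<close> by (auto simp: asym_iff)
  have "card (R\<inverse> `` {v}) \<le> card ((R\<inverse>)\<inverse> `` {v}) \<and> 0 < card ((R\<inverse>)\<inverse> `` {v})" if "v \<in> W'" for v
    using that pos[of v] by (auto simp: W'_def)
  from one_way_pair_of_in_dominated[OF finV conv \<open>W' \<subseteq> V\<close> this]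
  obtain A B where AB: "A \<subseteq> V" "B \<subseteq> V" "R\<inverse> \<inter> (B \<times> A) = {}"
    and le: "2 / 9 * card W' \<le> real L * card (R\<inverse> \<inter> (A \<times> B))"
    unfolding L_def cardV by blast
  note le
  \<comment> \<open>A one-way pair for the reversed arcs is one for \<open>R\<close> with the two
    sets exchanged.\<close>
  also have "R\<inverse> \<inter> (A \<times> B) = (R \<inter> (B \<times> A))\<inverse>" by auto
  also have "real L * card ((R \<inter> (B \<times> A))\<inverse>) \<le> real L * ow D"
    using ow_ge[of B A] AB by (intro mult_left_mono) auto
  finally have W'_le: "2 / 9 * card W' \<le> real L * ow D" .
  have "real n \<le> real (card W) + real (card W')" using half by linarith
  \<comment> \<open>Adding both estimates gives \<open>2 / 9 * n \<le> 2 * L * ow D\<close>.\<close>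
  then have bound: "real n \<le> 9 * real L * ow D" using W_le W'_le by simp
  show ?thesis
  \<comment> \<open>If \<open>L = 0\<close>, the bound forces \<open>n = 0\<close> and the quotient
    is 0; otherwise the ceiling is positive and \<open>nat\<close> preserves it.\<close>
  proof (cases "L = 0")
    case True
    then show ?thesis using bound by simp
  next
    case False
    then have "real_of_int \<lceil>log 2 (real n)\<rceil> = real L" by (simp add: L_def)
    then show ?thesis using False bound by (simp add: divide_le_eq mult.commute mult.left_commute)
  qed
qed

end
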